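(* Let $q$ be a prime power, let $n\ge 2$ be an integer, let $d=\lfloor n/2\rfloor$, and let $1 \le j \le d$. Then: (i) $\min_{0\leq i\leq d} A_j(i) = A_j(d-j+1)$. (ii) $\max_{1\leq i \leq d} |A_j(i)| = |A_j(1)|$. (iii) Let $0 \le i \le d-1$, $1 \le j \le d$. Then: a) $|A_j(i)| < |A_j(i+1)|$ if and only if $(q,n,i) = (2,2d,d-1)$ and $1 \le j \le d-1$. b) $|A_j(i)| = |A_j(i+1)|$ if and only if $(q,n,i) = (2,2d,d-1)$ and $j = d$. c) In all other cases $|A_j(i)| > |A_j(i+1)|$.
   Context: Put $b=q^2$ and $m = n(n-1)/(2d) = 2n-2d-1$. With Gaussian coefficients in base $b$, $\genfrac{[}{]}{0pt}{}{a}{k}_b = \prod_{h=0}^{k-1}\frac{b^{a-h}-1}{b^{k-h}-1}$ (and $0$ if $k<0$), for $0\le i,j\le d$, $$A_j(i) = \sum_{h=0}^j (-1)^{j-h} \, q^{(j-h)(j-h-1)} \, q^{hm} \genfrac{[}{]}{0pt}{}{d-h}{d-j}_b \genfrac{[}{]}{0pt}{}{d-i}{h}_b.$$ The numbers $A_j(i)$, $0\le i\le d$, are the eigenvalues of the distance-$j$ graph of the alternating forms graph $A_q(n)$, whose vertices are the skew-symmetric $n\times n$ matrices over $\mathbb{F}_q$ with zero diagonal, adjacent when their difference has rank 2; this graph is distance-regular with diameter $d$.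
   Formalization: Part (ii) is proved for (q,n,j) ≠ (2,4,1); in that single case it is false, since A_1(1) = 3 and A_1(2) = -5, so the maximum of |A_1(i)| over 1 ≤ i ≤ 2 is 5, not |A_1(1)| = 3. *)

theory Defs
  imports Complex_Main "HOL-Number_Theory.Prime_Powers"
begin

(* Both arguments are natural numbers, so the convention for a negative lower index is vacuous.
   If a < k, the factor h = a is 0 and the product vanishes, exactly as with integer exponents;
   the truncation of a - h for h > a is therefore harmless. *)
definition gauss_coeff :: "real \<Rightarrow> nat \<Rightarrow> nat \<Rightarrow> real" where
  "gauss_coeff b a k = (\<Prod>h<k. (b ^ (a - h) - 1) / (b ^ (k - h) - 1))"

(* The number A_j(i) for the alternating forms graph A_q(n), in the order q n j i.
   It is meant for n >= 2 and i, j <= n div 2, where no subtraction below truncates. *)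
definition alt_eigenvalue :: "nat \<Rightarrow> nat \<Rightarrow> nat \<Rightarrow> nat \<Rightarrow> real" where
  "alt_eigenvalue q n j i =
     (let d = n div 2; m = 2 * n - 2 * d - 1; b = (real q)\<^sup>2 in
      \<Sum>h=0..j. (-1) ^ (j - h) * real q ^ ((j - h) * (j - h - 1)) * real q ^ (h * m)
             * gauss_coeff b (d - h) (d - j) * gauss_coeff b (d - i) h)"

lemma alt_exponent:
  fixes n d :: nat
  assumes "n \<ge> 2" and "d = n div 2"
  shows "real (2 * n - 2 * d - 1) = real n * (real n - 1) / (2 * real d)"
proof -
  have "n = 2 * d \<or> n = 2 * d + 1" and "d \<ge> 1" using assms by arith+
  then show ?thesis by (auto simp: field_simps of_nat_diff)
qed

(* The bound max {|A_j(i)| : 1 <= i <= d} = |A_j(1)| fails for (q,n,j) = (2,4,1),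
   where A_1(1) = 3 and A_1(2) = -5. *)
lemma alt_eigenvalue_2_4_1:
  "alt_eigenvalue 2 4 1 1 = 3" "alt_eigenvalue 2 4 1 2 = -5"
  by (simp_all add: alt_eigenvalue_def gauss_coeff_def Let_def numeral_2_eq_2[symmetric]
       lessThan_Suc atLeast0_atMost_Suc)

lemma alt_max_exception:
  "Max ((\<lambda>i. \<bar>alt_eigenvalue 2 4 1 i\<bar>) ` {1..2}) \<noteq> \<bar>alt_eigenvalue 2 4 1 1\<bar>"
proof -
  have "{1..2::nat} = {1, 2}" by auto
  then show ?thesis by (simp add: alt_eigenvalue_2_4_1 del: One_nat_def)
qed

end

theory Submission
  imports Defs
begin

text \<open>
  Write \<open>b = q\<^sup>2\<close> and \<open>q\<^sup>m = s b\<^sup>d\<close>, so that \<open>s = 1/q\<close> or \<open>s = q\<close> depends only on the parity of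
  \<open>n\<close>. Pascal's rule gives \<open>A\<^sub>j(i) - A\<^sub>j(i+1) = s b\<^bsup>2d-i-1\<^esup> A'\<^bsub>j-1\<^esub>(i)\<close>, where \<open>A'\<close> belongs to \<open>d - 1\<close>
  and the same \<open>s\<close>. By induction on \<open>d\<close>, \<open>A\<^sub>j(i)\<close> is positive and decreasing for \<open>i \<le> d - j\<close>. From
  there on its signs alternate, so the absolute value of the difference is the sum of two consecutive
  absolute values; as \<open>|A'\<^bsub>j-1\<^esub>(i+1)| \<le> 2 |A'\<^bsub>j-1\<^esub>(i)|\<close> and \<open>b \<ge> 4\<close>, these sums at least halve at
  each step, which forces the absolute values to decrease. Only the last step \<open>i = d - 1\<close>, where both
  values are explicit, can fail.
\<close>

section \<open>Descent in a sequence with known sums of neighbours\<close>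

text \<open>Halving gives \<open>X i >= X (i+1) + 2 * X (i+2)\<close>, so positivity of two
  successors yields positivity and both strict inequalities at \<open>i\<close>; this propagates
  downwards from the end. The bound on \<open>X (Suc d)\<close> amounts to
  \<open>X (Suc d) <= 2 * X d\<close>: at the last step descent may fail, but doubling
  survives.\<close>

lemma alternating_descent:
  fixes X Z :: "nat \<Rightarrow> real"
  assumes XZ: "\<And>i. a \<le> i \<Longrightarrow> i \<le> d \<Longrightarrow> X i + X (Suc i) = Z i"
    and Zpos: "\<And>i. a \<le> i \<Longrightarrow> i \<le> d \<Longrightarrow> 0 < Z i"
    and half: "\<And>i. a \<le> i \<Longrightarrow> i < d \<Longrightarrow> 2 * Z (Suc i) \<le> Z i"
    and last: "0 < X (Suc d)" "3 * X (Suc d) \<le> 2 * Z d"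
  shows alternating_descent_pos: "\<And>i. a \<le> i \<Longrightarrow> i \<le> Suc d \<Longrightarrow> 0 < X i"
    and alternating_descent_less: "\<And>i. a \<le> i \<Longrightarrow> i < d \<Longrightarrow> X (Suc i) < X i"
    and alternating_descent_less2: "\<And>i. a \<le> i \<Longrightarrow> i < d \<Longrightarrow> X (Suc (Suc i)) < X i"
    and alternating_descent_double: "\<And>i. a \<le> i \<Longrightarrow> i \<le> d \<Longrightarrow> X (Suc i) \<le> 2 * X i"
proof -
  have local_descent: "0 < X i \<and> X (Suc i) < X i \<and> X (Suc (Suc i)) < X i"
    if "a \<le> i" "i < d" "0 < X (Suc i)" "0 < X (Suc (Suc i))" for i
    using XZ[of i] XZ[of "Suc i"] half[of i] that by auto
  have pos: "0 < X i \<and> 0 < X (Suc i)" if "a \<le> i" "i \<le> d" for i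
    using that(2,1)
  proof (induction rule: inc_induct)
    case base
    then show ?case using last XZ[of d] Zpos[of d] by auto
  next
    case (step n)
    then show ?case using local_descent[of n] by auto
  qed
  show "0 < X i" if "a \<le> i" "i \<le> Suc d" for i
    using that pos[of i] last by (cases "i = Suc d") auto
  show less: "X (Suc i) < X i" if "a \<le> i" "i < d" for i
    using that local_descent[of i] pos[of i] pos[of "Suc i"] by auto
  show "X (Suc (Suc i)) < X i" if "a \<le> i" "i < d" for i
    using that local_descent[of i] pos[of i] pos[of "Suc i"] by auto
  show "X (Suc i) \<le> 2 * X i" if "a \<le> i" "i \<le> d" for i
    using that less[of i] pos[of i] last XZ[of d] by (cases "i = d") auto
qed

section \<open>Gaussian coefficients\<close>

lemma gauss_coeff_0 [simp]: "gauss_coeff b a 0 = 1"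
  by (simp add: gauss_coeff_def)

lemma gauss_coeff_eq_0: "a < k \<Longrightarrow> gauss_coeff b a k = 0"
  by (auto simp: gauss_coeff_def intro!: prod_zero bexI[of _ a])

lemma gauss_coeff_pos:
  assumes "b > 1" "k \<le> a"
  shows "gauss_coeff b a k > 0"
  unfolding gauss_coeff_def
  by (intro prod_pos divide_pos_pos) (use assms in \<open>auto intro!: one_less_power\<close>)

lemma gauss_coeff_self [simp]:
  assumes "b > 1"
  shows "gauss_coeff b a a = 1"
  unfolding gauss_coeff_def
proof (intro prod.neutral ballI)
  fix h assume "h \<in> {..<a}"
  then have "b ^ (a - h) > 1" using assms by (intro one_less_power) auto
  then show "(b ^ (a - h) - 1) / (b ^ (a - h) - 1) = 1" by simp
qed

lemma gauss_coeff_Suc_Suc: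
  "gauss_coeff b (Suc a) (Suc k) = (b ^ Suc a - 1) / (b ^ Suc k - 1) * gauss_coeff b a k"
  unfolding gauss_coeff_def by (subst prod.lessThan_Suc_shift) simp

lemma gauss_coeff_Suc_right:
  assumes "b > 1"
  shows "gauss_coeff b a (Suc k) = (b ^ (a - k) - 1) / (b ^ Suc k - 1) * gauss_coeff b a k"
proof -
  have "(\<Prod>h<Suc k. b ^ (Suc k - h) - 1) = (b ^ Suc k - 1) * (\<Prod>h<k. b ^ (k - h) - 1)"
    by (subst prod.lessThan_Suc_shift) simp
  moreover have "(\<Prod>h<Suc k. b ^ (a - h) - 1) = (b ^ (a - k) - 1) * (\<Prod>h<k. b ^ (a - h) - 1)"
    by simp
  ultimately show ?thesis
    unfolding gauss_coeff_def prod_dividef by (metis times_divide_times_eq)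
qed

text \<open>After removing common factors this is
  \<open>b^(a+1) - 1 = (b^(a-k) - 1) + b^(a-k) * (b^(k+1) - 1)\<close>. For \<open>k > a\<close> all
  three coefficients vanish, so truncation of \<open>a - k\<close> is harmless.\<close>

lemma gauss_coeff_pascal:
  assumes "b > 1"
  shows "gauss_coeff b (Suc a) (Suc k) = gauss_coeff b a (Suc k) + b ^ (a - k) * gauss_coeff b a k"
proof (cases "k \<le> a")
  case True
  have "b ^ Suc k > 1" using assms by (intro one_less_power) auto
  moreover have "b ^ Suc a = b ^ (a - k) * b ^ Suc k"
    using True by (simp flip: power_add)
  ultimately show ?thesis
    unfolding gauss_coeff_Suc_Suc gauss_coeff_Suc_right[OF assms]
    by (simp add: divide_simps del: power_Suc) (simp add: algebra_simps)
next
  case False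
  then show ?thesis by (simp add: gauss_coeff_eq_0)
qed

text \<open>Equates two expansions of the coefficient with indices \<open>Suc a\<close> and
  \<open>Suc k\<close>.\<close>

lemma gauss_coeff_Suc_left:
  assumes "b > 1" "k \<le> a"
  shows "(b ^ (Suc a - k) - 1) * gauss_coeff b (Suc a) k = (b ^ Suc a - 1) * gauss_coeff b a k"
proof -
  have "b ^ Suc k > 1" using assms by (intro one_less_power) auto
  then show ?thesis
    using gauss_coeff_Suc_Suc[of b a k] gauss_coeff_Suc_right[OF assms(1), of "Suc a" k]
    by (simp add: divide_simps del: power_Suc)
qed

section \<open>The eigenvalues as a family with parameter \<open>s\<close>\<close>

text \<open>The real \<open>s\<close> stands for the quotient of \<open>q ^ m\<close> by
  \<open>b ^ d\<close>; holding it fixed while \<open>d\<close> varies is what permits induction on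
  \<open>d\<close>.\<close>

definition forms_eigenvalue :: "real \<Rightarrow> real \<Rightarrow> nat \<Rightarrow> nat \<Rightarrow> nat \<Rightarrow> real" where
  "forms_eigenvalue q s d j i =
     (\<Sum>h\<le>j. (-1) ^ (j - h) * q ^ ((j - h) * (j - h - 1)) * (s * (q\<^sup>2) ^ d) ^ h
            * gauss_coeff (q\<^sup>2) (d - h) (d - j) * gauss_coeff (q\<^sup>2) (d - i) h)"

text \<open>The exponent \<open>m\<close> is \<open>2 * d - 1\<close> for even \<open>n\<close> and
  \<open>2 * d + 1\<close> for odd \<open>n\<close>, whence the two values of
  \<open>s\<close>.\<close>

lemma alt_eigenvalue_eq_forms_eigenvalue:
  assumes "q > 0" "d = n div 2" "d \<ge> 1"
  shows "alt_eigenvalue q n j i = forms_eigenvalue q (if even n then 1 / q else q) d j i"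
proof -
  have m: "real q ^ (2 * n - 2 * d - 1) = (if even n then 1 / q else q) * ((real q)\<^sup>2) ^ d"
  proof (cases "even n")
    case True
    then have n: "n = 2 * d" using assms by simp
    obtain k where "d = Suc k" using assms(3) Suc_le_D by auto
    then show ?thesis using assms(1) n by (simp add: power_mult) (simp add: power2_eq_square)
  next
    case False
    then have "2 * n - 2 * d - 1 = Suc (2 * d)" using assms by presburger
    then show ?thesis using False by (simp flip: power_mult)
  qed
  show ?thesis
    unfolding alt_eigenvalue_def forms_eigenvalue_def Let_def assms(2)[symmetric] m[symmetric]
    by (simp add: atLeast0AtMost mult.commute flip: power_mult)
qed

context
  fixes q s :: real
  assumes q: "q \<ge> 2" and s: "s \<ge> 1 / q"
begin

private abbreviation "b \<equiv> q\<^sup>2"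
private abbreviation "A \<equiv> forms_eigenvalue q s"

private lemma b_ge_4: "b \<ge> 4"
  using power_mono[OF q, of 2] by simp

private lemma b_gt_1: "b > 1"
  using b_ge_4 by simp

private lemma s_pos: "s > 0"
  using q s by (smt (verit) divide_pos_pos)

private lemma diff_coeff_pos: "s * b ^ k > 0"
  using s_pos q by simp

lemma forms_eigenvalue_0: "A d 0 i = 1"
  using b_gt_1 by (simp add: forms_eigenvalue_def)

lemma forms_eigenvalue_last:
  "A d j d = (-1) ^ j * q ^ (j * (j - 1)) * gauss_coeff b d (d - j)"
proof -
  have "A d j d = (\<Sum>h\<in>{0}. (-1) ^ (j - h) * q ^ ((j - h) * (j - h - 1)) * (s * b ^ d) ^ h
            * gauss_coeff b (d - h) (d - j) * gauss_coeff b (d - d) h)"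
    unfolding forms_eigenvalue_def
    by (rule sum.mono_neutral_right) (auto simp: gauss_coeff_eq_0)
  then show ?thesis by simp
qed

lemma forms_eigenvalue_diff:
  assumes "i \<le> d"
  shows "A (Suc d) (Suc j) i - A (Suc d) (Suc j) (Suc i) = s * b ^ (2 * d + 1 - i) * A d j i"
proof -
  \<comment> \<open>\<open>T\<close> collects the factors free of \<open>i\<close>, so Pascal's rule
    acts on the remaining one; the terms with \<open>h = 0\<close> cancel and the index
    shifts.\<close>
  define T where "T = (\<lambda>h. (-1) ^ (Suc j - h) * q ^ ((Suc j - h) * (Suc j - h - 1))
    * (s * b ^ Suc d) ^ h * gauss_coeff b (Suc d - h) (d - j))"
  have "A (Suc d) (Suc j) i - A (Suc d) (Suc j) (Suc i)
      = (\<Sum>h\<le>Suc j. T h * (gauss_coeff b (Suc (d - i)) h - gauss_coeff b (d - i) h))"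
    using assms by (simp add: forms_eigenvalue_def T_def Suc_diff_le right_diff_distrib
        del: sum.atMost_Suc power_Suc flip: sum_subtractf)
  also have "\<dots> = (\<Sum>h\<le>j. T (Suc h) * (b ^ (d - i - h) * gauss_coeff b (d - i) h))"
    by (subst sum.atMost_Suc_shift) (simp add: gauss_coeff_pascal[OF b_gt_1])
  also have "\<dots> = s * b ^ (2 * d + 1 - i) * A d j i"
    unfolding forms_eigenvalue_def sum_distrib_left
  proof (intro sum.cong refl)
    fix h
    show "T (Suc h) * (b ^ (d - i - h) * gauss_coeff b (d - i) h)
      = s * b ^ (2 * d + 1 - i) * ((-1) ^ (j - h) * q ^ ((j - h) * (j - h - 1)) * (s * b ^ d) ^ h
         * gauss_coeff b (d - h) (d - j) * gauss_coeff b (d - i) h)"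
    \<comment> \<open>The exponent \<open>d - i - h\<close> truncates for larger \<open>h\<close>,
      but there \<open>gauss_coeff b (d - i) h\<close> is zero.\<close>
    proof (cases "h \<le> d - i")
      case True
      have "(s * b ^ Suc d) ^ Suc h * b ^ (d - i - h) = s ^ Suc h * b ^ (Suc d * Suc h + (d - i - h))"
        by (simp only: power_mult_distrib power_add power_mult mult.assoc)
      also have "Suc d * Suc h + (d - i - h) = (2 * d + 1 - i) + d * h"
        using True assms by (simp add: algebra_simps)
      also have "s ^ Suc h * b ^ \<dots> = s * b ^ (2 * d + 1 - i) * (s * b ^ d) ^ h"
        by (simp add: power_mult_distrib power_add power_mult)
      finally have e: "(s * b ^ Suc d) ^ Suc h * b ^ (d - i - h)
        = s * b ^ (2 * d + 1 - i) * (s * b ^ d) ^ h" .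
      have "T (Suc h) * (b ^ (d - i - h) * gauss_coeff b (d - i) h)
        = (-1) ^ (j - h) * q ^ ((j - h) * (j - h - 1)) * ((s * b ^ Suc d) ^ Suc h * b ^ (d - i - h))
         * gauss_coeff b (d - h) (d - j) * gauss_coeff b (d - i) h"
        by (simp add: T_def mult_ac del: power_Suc)
      then show ?thesis unfolding e by (simp add: mult_ac)
    next
      case False
      then show ?thesis by (simp add: gauss_coeff_eq_0)
    qed
  qed
  finally show ?thesis .
qed

section \<open>Normalised signs and the induction on \<open>d\<close>\<close>

text \<open>Meant for \<open>d <= i + j\<close>, where the sign turns out to make this the absolute
  value of the eigenvalue.\<close>

private definition X :: "nat \<Rightarrow> nat \<Rightarrow> nat \<Rightarrow> real" where
  "X d j i = (-1) ^ (i + j - d) * A d j i"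

private definition Z :: "nat \<Rightarrow> nat \<Rightarrow> nat \<Rightarrow> real" where
  "Z d j i = s * b ^ (2 * d + 1 - i) * X d j i"

text \<open>The signs at \<open>i\<close> and \<open>Suc i\<close> are opposite, which turns the
  difference formula into a sum.\<close>

private lemma X_sum:
  assumes "d \<le> i + j" "i \<le> d"
  shows "X (Suc d) (Suc j) i + X (Suc d) (Suc j) (Suc i) = Z d j i"
proof -
  have "X (Suc d) (Suc j) i + X (Suc d) (Suc j) (Suc i)
    = (-1) ^ (i + j - d) * (A (Suc d) (Suc j) i - A (Suc d) (Suc j) (Suc i))"
    using assms by (simp add: X_def Suc_diff_le algebra_simps)
  then show ?thesis
    unfolding forms_eigenvalue_diff[OF assms(2)] Z_def X_def by simp
qed

private lemma X_last: "j \<le> d \<Longrightarrow> X d j d = q ^ (j * (j - 1)) * gauss_coeff b d (d - j)"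
  by (simp add: X_def forms_eigenvalue_last flip: mult.assoc power_add)

private lemma X_last_pos: "j \<le> d \<Longrightarrow> X d j d > 0"
  using q by (simp add: X_last gauss_coeff_pos[OF b_gt_1])

text \<open>Both sides are explicit at \<open>i = d\<close>. The cleared denominators make this
  exact ratio usable both for a bound and for the final equality case.\<close>

private lemma X_last_Z:
  assumes "j \<le> d"
  shows "s * b ^ Suc d * (b ^ Suc j - 1) * X (Suc d) (Suc j) (Suc d)
     = b ^ j * (b ^ Suc d - 1) * Z d j d"
proof -
  have "Suc j * (Suc j - 1) = 2 * j + j * (j - 1)"
    by (cases j) auto
  then have p: "q ^ (Suc j * (Suc j - 1)) = b ^ j * q ^ (j * (j - 1))"
    by (simp only: power_add power_mult)
  have g: "(b ^ Suc j - 1) * gauss_coeff b (Suc d) (d - j) = (b ^ Suc d - 1) * gauss_coeff b d (d - j)"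
    using gauss_coeff_Suc_left[OF b_gt_1, of "d - j" d] assms by (simp add: Suc_diff_le)
  have "X (Suc d) (Suc j) (Suc d) = b ^ j * q ^ (j * (j - 1)) * gauss_coeff b (Suc d) (d - j)"
    using X_last[of "Suc j" "Suc d"] assms p by simp
  then have "s * b ^ Suc d * (b ^ Suc j - 1) * X (Suc d) (Suc j) (Suc d)
    = s * b ^ Suc d * b ^ j * q ^ (j * (j - 1)) * ((b ^ Suc j - 1) * gauss_coeff b (Suc d) (d - j))"
    by (simp add: mult_ac del: power_Suc)
  also have "\<dots> = b ^ j * (b ^ Suc d - 1) * Z d j d"
    using assms unfolding g Z_def by (simp add: X_last mult_ac Suc_diff_le del: power_Suc)
  finally show ?thesis .
qed

text \<open>By the exact ratio it suffices that \<open>3 * b^j <= 2 * s * (b^(j+1) - 1)\<close>.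
  Inserting \<open>s >= 1/q\<close> reduces this to \<open>2 * q^2 - 3 * q >= 2\<close>, which is
  sharp at \<open>q = 2\<close>.\<close>

private lemma X_last_le:
  assumes "j \<le> d"
  shows "3 * X (Suc d) (Suc j) (Suc d) \<le> 2 * Z d j d"
proof -
  have bj: "b ^ j \<ge> 1" using b_gt_1 by simp
  have "2 * b ^ Suc j - 2 - 3 * q * b ^ j = b ^ j * (2 * b - 3 * q) - 2"
    by (simp add: algebra_simps)
  moreover have "2 * b - 3 * q \<ge> 2"
  proof -
    have "0 \<le> (q - 2) * (2 * q + 1)" using q by simp
    then show ?thesis by (simp add: algebra_simps power2_eq_square)
  qed
  ultimately have "2 * (b ^ Suc j - 1) - 3 * q * b ^ j \<ge> 0"
    using mult_mono[OF bj \<open>2 * b - 3 * q \<ge> 2\<close>] by simp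
  then have "3 * b ^ j \<le> 2 * (b ^ Suc j - 1) * (1 / q)"
    using q by (simp add: field_simps)
  also have "\<dots> \<le> 2 * (b ^ Suc j - 1) * s"
    using s b_gt_1 by (intro mult_left_mono) (auto simp del: power_Suc)
  finally have *: "3 * b ^ j \<le> 2 * (b ^ Suc j - 1) * s" .
  have Zp: "Z d j d > 0"
    unfolding Z_def by (intro mult_pos_pos[OF diff_coeff_pos] X_last_pos assms)
  have "s * b ^ Suc d * (b ^ Suc j - 1) * (3 * X (Suc d) (Suc j) (Suc d))
      = 3 * b ^ j * ((b ^ Suc d - 1) * Z d j d)"
    using X_last_Z[OF assms] by simp
  also have "\<dots> \<le> 2 * (b ^ Suc j - 1) * s * ((b ^ Suc d - 1) * Z d j d)"
    using * Zp b_gt_1 by (intro mult_right_mono) (auto simp del: power_Suc)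
  also have "\<dots> \<le> 2 * (b ^ Suc j - 1) * s * (b ^ Suc d * Z d j d)"
    using s_pos Zp b_gt_1 by (intro mult_left_mono mult_right_mono) (auto simp del: power_Suc)
  also have "\<dots> = s * b ^ Suc d * (b ^ Suc j - 1) * (2 * Z d j d)"
    by simp
  finally show ?thesis
    using mult_pos_pos[OF diff_coeff_pos, of "b ^ Suc j - 1" "Suc d"]
      one_less_power[OF b_gt_1, of "Suc j"]
    by (subst (asm) mult_le_cancel_left_pos) simp_all
qed

text \<open>The weight drops by the factor \<open>b >= 4\<close> while \<open>X\<close> at most
  doubles.\<close>

private lemma Z_half:
  assumes "X d j (Suc i) \<le> 2 * X d j i" "0 \<le> X d j i" "i < d"
  shows "2 * Z d j (Suc i) \<le> Z d j i"
proof -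
  have e: "2 * d + 1 - i = Suc (2 * d - i)" using assms by simp
  have "2 * Z d j (Suc i) = s * b ^ (2 * d - i) * (2 * X d j (Suc i))"
    by (simp add: Z_def)
  also have "\<dots> \<le> s * b ^ (2 * d - i) * (b * X d j i)"
    using assms s_pos mult_right_mono[OF b_ge_4 assms(2)] by (intro mult_left_mono) auto
  finally show ?thesis unfolding Z_def e by (simp add: mult_ac)
qed

text \<open>Doubling for \<open>d\<close> gives halving of \<open>Z\<close>, and
  \<open>alternating_descent\<close> returns positivity and doubling for \<open>Suc d\<close>. Plain
  descent could not serve as induction hypothesis, since the last step may increase.\<close>

private lemma X_pos_double:
  assumes "j \<le> d" "d \<le> i + j" "i \<le> d"
  shows "0 < X d j i \<and> (i < d \<longrightarrow> X d j (Suc i) \<le> 2 * X d j i)"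
  using assms
proof (induction d arbitrary: i j)
  case 0
  then show ?case by (simp add: X_def forms_eigenvalue_0)
next
  case (Suc d)
  show ?case
  proof (cases j)
    case 0
    then show ?thesis using Suc.prems by (simp add: X_def forms_eigenvalue_0)
  next
    case (Suc j')
    have j': "j' \<le> d" using Suc Suc.prems by simp
    have pos: "0 < Z d j' k" if "d - j' \<le> k" "k \<le> d" for k
      using Suc.IH[OF j', of k] that mult_pos_pos[OF diff_coeff_pos] by (simp add: Z_def)
    have half: "2 * Z d j' (Suc k) \<le> Z d j' k" if "d - j' \<le> k" "k < d" for k
      proof -
      have "d \<le> k + j'" using that by linarith
      then show ?thesis using Suc.IH[OF j', of k] that by (intro Z_half) auto
    qed
    note hyps = X_sum pos half X_last_pos X_last_le[OF j']
    show ?thesis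
      using Suc.prems alternating_descent_pos[where a = "d - j'" and d = d and X = "X (Suc d) (Suc j')"
          and Z = "Z d j'" and i = i, OF hyps]
        alternating_descent_double[where a = "d - j'" and d = d and X = "X (Suc d) (Suc j')"
          and Z = "Z d j'" and i = i, OF hyps] j'
      unfolding Suc by auto
  qed
qed

private lemma Z_pos:
  assumes "j \<le> d" "d \<le> i + j" "i \<le> d"
  shows "Z d j i > 0"
  using X_pos_double[OF assms] mult_pos_pos[OF diff_coeff_pos] by (simp add: Z_def)

private lemma Z_Suc_le:
  assumes "j \<le> d" "d \<le> i + j" "i < d"
  shows "2 * Z d j (Suc i) \<le> Z d j i"
  using X_pos_double[of j d i] assms by (intro Z_half) auto

private lemma abs_forms_eigenvalue:
  assumes "j \<le> d" "d \<le> i + j" "i \<le> d"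
  shows "\<bar>A d j i\<bar> = X d j i"
proof -
  have "\<bar>A d j i\<bar> = \<bar>X d j i\<bar>" by (simp add: X_def abs_mult power_abs)
  then show ?thesis using X_pos_double[OF assms] by simp
qed

section \<open>Signs and strict descent of the eigenvalues\<close>

lemma forms_eigenvalue_pos:
  assumes "i + j \<le> d"
  shows "A d j i > 0"
  using assms
proof (induction d arbitrary: i j)
  case 0
  then show ?case by (simp add: forms_eigenvalue_0)
next
  case (Suc d)
  show ?case
  proof (cases j)
    case 0
    then show ?thesis by (simp add: forms_eigenvalue_0)
  next
    case (Suc j')
    \<comment> \<open>The inner induction descends from \<open>i = Suc d - j\<close>, where the sign
      exponent in \<open>X\<close> is 0; the differences are positive by the outer
      hypothesis.\<close>
    have "i \<le> d - j'" using Suc.prems Suc by simp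
    then show ?thesis
    proof (induction rule: inc_induct)
      case base
      then show ?case
        using X_pos_double[of j "Suc d" "d - j'"] Suc Suc.prems by (simp add: X_def)
    next
      case (step k)
      have "0 < s * b ^ (2 * d + 1 - k) * A d j' k"
        using Suc.IH[of k j'] step.hyps by (intro mult_pos_pos[OF diff_coeff_pos]) simp
      then show ?case
        using forms_eigenvalue_diff[of k d j'] step Suc by (smt (verit) diff_le_self le_trans less_imp_le)
    qed
  qed
qed

lemma forms_eigenvalue_sign:
  assumes "j \<le> d" "d \<le> i + j" "i \<le> d"
  shows "(-1) ^ (i + j - d) * A d j i > 0"
  using X_pos_double[OF assms] by (simp add: X_def)

lemma abs_forms_eigenvalue_Suc_less:
  assumes "1 \<le> j" "j \<le> d" "Suc i < d"
  shows "\<bar>A d j (Suc i)\<bar> < \<bar>A d j i\<bar>"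
proof -
  obtain d' j' where dj: "d = Suc d'" "j = Suc j'"
    using assms by (metis Suc_le_D One_nat_def)
  show ?thesis
  proof (cases "d \<le> i + j")
    case True
    then show ?thesis
      using alternating_descent_less[where a = "d' - j'" and d = d' and X = "X (Suc d') (Suc j')"
          and Z = "Z d' j'" and i = i, OF X_sum Z_pos Z_Suc_le X_last_pos X_last_le] assms dj
      by (simp add: abs_forms_eigenvalue)
  next
    case False
    then have "0 < s * b ^ (2 * d' + 1 - i) * A d' j' i"
      using forms_eigenvalue_pos[of i j' d'] dj by (intro mult_pos_pos[OF diff_coeff_pos]) simp
    then show ?thesis
      using forms_eigenvalue_diff[of i d' j'] False dj assms
        forms_eigenvalue_pos[of i j d] forms_eigenvalue_pos[of "Suc i" j d] by simp
  qed
qed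

text \<open>Unlike the one-step comparison this reaches the index \<open>d\<close>, so a rise at the
  last step does no harm when two steps are taken at once.\<close>

lemma abs_forms_eigenvalue_Suc_Suc_less:
  assumes "1 \<le> j" "j \<le> d" "Suc i < d"
  shows "\<bar>A d j (Suc (Suc i))\<bar> < \<bar>A d j i\<bar>"
proof -
  obtain d' j' where dj: "d = Suc d'" "j = Suc j'"
    using assms by (metis Suc_le_D One_nat_def)
  consider "d \<le> i + j" | "Suc (Suc i) + j \<le> d" | "d = Suc (i + j)"
    by linarith
  then show ?thesis
  proof cases
    case 1
    then show ?thesis
      using alternating_descent_less2[where a = "d' - j'" and d = d' and X = "X (Suc d') (Suc j')"
          and Z = "Z d' j'" and i = i, OF X_sum Z_pos Z_Suc_le X_last_pos X_last_le] assms dj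
      by (simp add: abs_forms_eigenvalue)
  next
    case 2
    then show ?thesis
      using abs_forms_eigenvalue_Suc_less[OF assms] abs_forms_eigenvalue_Suc_less[of j d "Suc i"] assms
      by simp
  next
    case 3
    then have d': "d' = i + j" using dj by simp
    \<comment> \<open>\<open>A\<^sub>j(i+2) < 0 < A\<^sub>j(i+1)\<close>, so the two consecutive differences have to be compared.\<close>
    have "A d j i - A d j (Suc i) = s * b ^ (2 * d' + 1 - i) * A d' j' i"
      using forms_eigenvalue_diff[of i d' j'] dj d' by simp
    moreover have "A d j (Suc i) - A d j (Suc (Suc i)) = s * b ^ (2 * d' - i) * A d' j' (Suc i)"
      using forms_eigenvalue_diff[of "Suc i" d' j'] dj d' by simp
    moreover have "s * b ^ (2 * d' - i) * A d' j' (Suc i) \<le> s * b ^ (2 * d' + 1 - i) * A d' j' i"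
    proof (rule mult_mono)
      show "A d' j' (Suc i) \<le> A d' j' i"
        using abs_forms_eigenvalue_Suc_less[of j' d' i] forms_eigenvalue_pos[of "Suc i" j' d']
          forms_eigenvalue_pos[of i j' d'] d' dj by (cases j') (auto simp: forms_eigenvalue_0)
      show "s * b ^ (2 * d' - i) \<le> s * b ^ (2 * d' + 1 - i)"
        using s_pos b_gt_1 by (intro mult_left_mono power_increasing) auto
      show "0 \<le> s * b ^ (2 * d' + 1 - i)"
        using diff_coeff_pos by (rule less_imp_le)
      show "0 \<le> A d' j' (Suc i)"
        using forms_eigenvalue_pos[of "Suc i" j' d'] d' dj by simp
    qed
    \<comment> \<open>The larger first difference gives
      \<open>- A d j (i+2) <= A d j i - 2 * A d j (i+1)\<close>.\<close>
    ultimately show ?thesis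
      using forms_eigenvalue_pos[of i j d] forms_eigenvalue_pos[of "Suc i" j d] 3 dj
        forms_eigenvalue_sign[of j d "Suc (Suc i)"] assms by simp
  qed
qed

section \<open>The last step\<close>

text \<open>Two neighbours have sum \<open>Z\<close>, so their comparison is that of
  \<open>Z\<close> with \<open>2 * X d j d\<close>; \<open>X_last_Z\<close> makes the ratio of these
  \<open>v\<close> to \<open>u\<close>.\<close>

lemma abs_forms_eigenvalue_last:
  assumes "1 \<le> j" "j \<le> d"
  defines "u \<equiv> 2 * b ^ (j - 1) * (b ^ d - 1)" and "v \<equiv> s * b ^ d * (b ^ j - 1)"
  shows "\<bar>A d j (d - 1)\<bar> < \<bar>A d j d\<bar> \<longleftrightarrow> v < u"
    and "\<bar>A d j (d - 1)\<bar> = \<bar>A d j d\<bar> \<longleftrightarrow> v = u"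
proof -
  obtain d' j' where dj: "d = Suc d'" "j = Suc j'"
    using assms by (metis Suc_le_D One_nat_def)
  have XX: "X d j d' + X d j d = Z d' j' d'"
    using X_sum[of d' d' j'] dj by simp
  have "v * (2 * X d j d) = u * Z d' j' d'"
    using X_last_Z[of j' d'] assms dj by (simp add: u_def v_def mult_ac del: power_Suc)
  moreover have v: "v > 0"
    using diff_coeff_pos[of d] assms one_less_power[OF b_gt_1, of j] by (simp add: v_def)
  moreover have Z: "Z d' j' d' > 0"
    using Z_pos[of j' d' d'] dj assms by simp
  moreover have "Z d' j' d' < 2 * X d j d \<longleftrightarrow> v * Z d' j' d' < v * (2 * X d j d)"
    "Z d' j' d' = 2 * X d j d \<longleftrightarrow> v * Z d' j' d' = v * (2 * X d j d)"
    using v by auto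
  ultimately have *: "Z d' j' d' < 2 * X d j d \<longleftrightarrow> v < u" "Z d' j' d' = 2 * X d j d \<longleftrightarrow> v = u"
    by auto
  have "\<bar>A d j d\<bar> = X d j d" "\<bar>A d j (d - 1)\<bar> = X d j d'"
    using abs_forms_eigenvalue[of j d d] abs_forms_eigenvalue[of j d d'] assms dj by auto
  then show "\<bar>A d j (d - 1)\<bar> < \<bar>A d j d\<bar> \<longleftrightarrow> v < u" "\<bar>A d j (d - 1)\<bar> = \<bar>A d j d\<bar> \<longleftrightarrow> v = u"
    using * XX by auto
qed

end

text \<open>Applied with \<open>p = b^(j-1)\<close> and \<open>w = b^d\<close>, this says
  \<open>u < v\<close>. For \<open>s = 1/q\<close> it rests on \<open>q * (q - 2) * p >= 1\<close>,
  which breaks down at \<open>q = 2\<close>.\<close>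

lemma last_step_gt:
  fixes q p w s :: real
  assumes "q \<ge> 2" "p \<ge> 1" "w > 0" and s: "s = q \<or> s = 1 / q \<and> q \<ge> 3"
  shows "2 * p * (w - 1) < s * w * (q\<^sup>2 * p - 1)"
proof -
  have "2 * p \<le> s * (q\<^sup>2 * p - 1)"
    using s
  proof (elim disjE conjE)
    assume "s = q"
    have "q\<^sup>2 * p \<ge> 2\<^sup>2 * p" using assms by (intro mult_right_mono power_mono) auto
    then have "4 * p \<le> q\<^sup>2 * p" by simp
    then have "2 * p \<le> 2 * (q\<^sup>2 * p - 1)" using \<open>p \<ge> 1\<close> by argo
    also have "\<dots> \<le> q * (q\<^sup>2 * p - 1)"
      using \<open>q \<ge> 2\<close> \<open>p \<ge> 1\<close> \<open>4 * p \<le> q\<^sup>2 * p\<close> by (intro mult_right_mono) linarith+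
    finally show ?thesis using \<open>s = q\<close> by simp
  next
    assume "s = 1 / q" "q \<ge> 3"
    have "1 * 1 \<le> (q * (q - 2)) * p"
    proof (rule mult_mono)
      have "3 * 1 \<le> q * (q - 2)" using \<open>q \<ge> 3\<close> by (intro mult_mono) auto
      then show "1 \<le> q * (q - 2)" by simp
    qed (use assms \<open>q \<ge> 3\<close> in auto)
    then have "2 * p * q \<le> q\<^sup>2 * p - 1" by (simp add: algebra_simps power2_eq_square)
    then show ?thesis using \<open>s = 1 / q\<close> assms by (simp add: pos_le_divide_eq)
  qed
  then have "2 * p * w \<le> s * (q\<^sup>2 * p - 1) * w"
    using assms by (intro mult_right_mono) auto
  moreover have "2 * p * (w - 1) < 2 * p * w" using assms by simp
  ultimately show ?thesis by (simp add: mult_ac)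
qed

section \<open>Minimum, maximum and consecutive comparisons\<close>

theorem theorem8p3:
  fixes q n d j :: nat
  assumes "primepow q" and "n \<ge> 2" and "d = n div 2" and "1 \<le> j" and "j \<le> d"
  shows
    "Min (alt_eigenvalue q n j ` {0..d}) = alt_eigenvalue q n j (d - j + 1)
     \<and> ((q, n, j) \<noteq> (2, 4, 1) \<longrightarrow>
          Max ((\<lambda>i. \<bar>alt_eigenvalue q n j i\<bar>) ` {1..d}) = \<bar>alt_eigenvalue q n j 1\<bar>)
     \<and> (\<forall>i. 0 \<le> i \<and> i \<le> d - 1 \<longrightarrow>
          (\<bar>alt_eigenvalue q n j i\<bar> < \<bar>alt_eigenvalue q n j (i + 1)\<bar>
             \<longleftrightarrow> (q, n, i) = (2, 2 * d, d - 1) \<and> 1 \<le> j \<and> j \<le> d - 1)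
        \<and> (\<bar>alt_eigenvalue q n j i\<bar> = \<bar>alt_eigenvalue q n j (i + 1)\<bar>
             \<longleftrightarrow> (q, n, i) = (2, 2 * d, d - 1) \<and> j = d)
        \<and> (\<not> ((q, n, i) = (2, 2 * d, d - 1) \<and> 1 \<le> j \<and> j \<le> d - 1)
           \<and> \<not> ((q, n, i) = (2, 2 * d, d - 1) \<and> j = d)
             \<longrightarrow> \<bar>alt_eigenvalue q n j i\<bar> > \<bar>alt_eigenvalue q n j (i + 1)\<bar>))"
proof -
  define s where "s = (if even n then 1 / real q else real q)"
  define E where "E = forms_eigenvalue q s d j"
  have "q \<ge> 2" using primepow_gt_Suc_0[OF assms(1)] by simp
  then have q: "real q \<ge> 2" by simp
  have "1 / real q \<le> real q" by (rule order_trans[of _ 1]) (use q in auto)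
  then have s: "s \<ge> 1 / real q" by (simp add: s_def)
  have d: "d \<ge> 1" using assms by linarith
  have alt: "alt_eigenvalue q n j = E"
    using alt_eigenvalue_eq_forms_eigenvalue[of q d n j] \<open>q \<ge> 2\<close> assms(3) d
    by (intro ext) (simp add: E_def s_def)
  have less: "\<bar>E (Suc i)\<bar> < \<bar>E i\<bar>" if "Suc i < d" for i
    unfolding E_def using abs_forms_eigenvalue_Suc_less[OF q s assms(4,5) that] .
  have less2: "\<bar>E (Suc (Suc i))\<bar> < \<bar>E i\<bar>" if "Suc i < d" for i
    unfolding E_def using abs_forms_eigenvalue_Suc_Suc_less[OF q s assms(4,5) that] .
  have last: "(\<bar>E (d - 1)\<bar> < \<bar>E d\<bar> \<longleftrightarrow> q = 2 \<and> n = 2 * d \<and> j < d) \<and>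
    (\<bar>E (d - 1)\<bar> = \<bar>E d\<bar> \<longleftrightarrow> q = 2 \<and> n = 2 * d \<and> j = d)"
  proof -
    define u v where "u = 2 * ((real q)\<^sup>2) ^ (j - 1) * (((real q)\<^sup>2) ^ d - 1)"
      and "v = s * ((real q)\<^sup>2) ^ d * (((real q)\<^sup>2) ^ j - 1)"
    have bj: "((real q)\<^sup>2) ^ j = (real q)\<^sup>2 * ((real q)\<^sup>2) ^ (j - 1)"
      using assms(4) by (cases j) auto
    have uv: "\<bar>E (d - 1)\<bar> < \<bar>E d\<bar> \<longleftrightarrow> v < u" "\<bar>E (d - 1)\<bar> = \<bar>E d\<bar> \<longleftrightarrow> v = u"
      using abs_forms_eigenvalue_last[OF q s assms(4,5)] by (simp_all add: E_def u_def v_def)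
    show ?thesis
    proof (cases "q = 2 \<and> n = 2 * d")
      case True
      then have s2: "s = 1 / 2" by (simp add: s_def)
      \<comment> \<open>The difference is nonnegative and vanishes only for \<open>j = d\<close>,
        which separates strict increase from equality.\<close>
      have "2 * (u - v) = 4 ^ d - 4 ^ j"
        using bj True unfolding u_def v_def s2 by (simp add: algebra_simps)
      then have "v = u - (4 ^ d - 4 ^ j) / 2" by argo
      then show ?thesis unfolding uv using True by auto
    next
      case False
      have "s = real q \<or> s = 1 / real q \<and> real q \<ge> 3"
        using False \<open>q \<ge> 2\<close> assms(3) by (auto simp: s_def)
      then have "u < v"
        using last_step_gt[of q "((real q)\<^sup>2) ^ (j - 1)" "((real q)\<^sup>2) ^ d" s] q
        unfolding u_def v_def bj by (simp add: one_le_power)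
      then show ?thesis unfolding uv using False by auto
    qed
  qed
  have "Min (E ` {0..d}) = E (d - j + 1)"
  proof (rule Min_eqI)
    \<comment> \<open>The first index with a negative value. Values at odd offsets from
      \<open>k\<close> are positive, so only even offsets compete, and they are reached in steps of
      two.\<close>
    define k where "k = d - j + 1"
    have sgn: "(-1) ^ t * E (k + t) < 0" if "k + t \<le> d" for t
      using forms_eigenvalue_sign[OF q s assms(5), of "k + t"] that assms(5)
      by (simp add: k_def E_def)
    have neg: "E k < 0" using sgn[of 0] assms(4,5) by (simp add: k_def)
    have even_step: "\<bar>E (k + 2 * t)\<bar> \<le> \<bar>E k\<bar>" if "k + 2 * t \<le> d" for t
      using that
    proof (induction t)
      case (Suc t)
      then show ?case using less2[of "k + 2 * t"] by simp
    qed simp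
    fix y assume "y \<in> E ` {0..d}"
    then obtain i where i: "i \<in> {0..d}" and y: "y = E i" by blast
    have "E k \<le> E i"
    proof (cases "i < k")
      case True
      then have "E i > 0"
        using forms_eigenvalue_pos[OF q s, of i j d] assms(5) by (simp add: k_def E_def)
      then show ?thesis using neg by simp
    next
      case False
      then obtain t where t: "i = k + t" using le_Suc_ex by (metis not_less)
      show ?thesis
      proof (cases "even t")
        case True
        then show ?thesis
          using even_step[of "t div 2"] sgn[of t] neg t i by simp
      next
        case False
        then show ?thesis using sgn[of t] neg t i by simp
      qed
    qed
    then show "E (d - j + 1) \<le> y" by (simp add: y k_def)
  qed (use assms in auto)
  moreover have "Max ((\<lambda>i. \<bar>E i\<bar>) ` {1..d}) = \<bar>E 1\<bar>" if exc: "(q, n, j) \<noteq> (2, 4, 1)"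
  proof -
    have desc: "\<bar>E (Suc i)\<bar> \<le> \<bar>E 1\<bar>" if "Suc i < d" for i
      using that
    proof (induction i)
      case (Suc i)
      then show ?case using less[of "Suc i"] by simp
    qed simp
    have "\<bar>E d\<bar> \<le> \<bar>E 1\<bar>"
    proof -
      \<comment> \<open>For \<open>d = 2\<close> the last step starts at index 1, and it increases
        exactly for \<open>(q, n, j) = (2, 4, 1)\<close>. From \<open>d = 3\<close> on, a double
        step ending at \<open>d\<close> starts at an index at least 1.\<close>
      consider "d = 1" | "d = 2" | k where "d = Suc (Suc (Suc k))"
        using d by (metis One_nat_def Suc_1 not0_implies_Suc not_one_le_zero)
      then show ?thesis
      proof cases
        case 1
        then show ?thesis by simp
      next
        case 2
        then have "\<not> \<bar>E 1\<bar> < \<bar>E d\<bar>" using last exc assms(4) by auto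
        then show ?thesis by simp
      next
        case 3
        then show ?thesis using less2[of "Suc k"] desc[of k] by simp
      qed
    qed
    moreover have "\<bar>E i\<bar> \<le> \<bar>E 1\<bar>" if "i \<in> {1..<d}" for i
      using desc[of "i - 1"] that by simp
    ultimately have "\<bar>E i\<bar> \<le> \<bar>E 1\<bar>" if "i \<in> {1..d}" for i
      using that by (cases "i = d") auto
    then show ?thesis using d by (intro Max_eqI) auto
  qed
  moreover have steps: "(\<bar>E i\<bar> < \<bar>E (i + 1)\<bar> \<longleftrightarrow> (q, n, i) = (2, 2 * d, d - 1) \<and> 1 \<le> j \<and> j \<le> d - 1)
      \<and> (\<bar>E i\<bar> = \<bar>E (i + 1)\<bar> \<longleftrightarrow> (q, n, i) = (2, 2 * d, d - 1) \<and> j = d)" if "i \<le> d - 1" for i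
  proof (cases "i = d - 1")
    case True
    then have "i + 1 = d" using d by simp
    then show ?thesis unfolding True using last assms(4) d by auto
  next
    case False
    then have "Suc i < d" using that by linarith
    then show ?thesis using less[of i] False by auto
  qed
  ultimately show ?thesis
    unfolding alt
  proof (intro conjI allI impI, goal_cases)
    \<comment> \<open>The strict descent in the remaining cases follows by trichotomy.\<close>
    case (5 i)
    then show ?case using steps[of i] linorder_less_linear[of "\<bar>E i\<bar>" "\<bar>E (i + 1)\<bar>"] by argo
  qed blast+
qed

end
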